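(* Let $\mathsf P$ be a one-move rider with basic move $(c,d)$ and let $q\ge2$. On the square board, the period of the quasipolynomial $u_{\mathsf P}(q;n)$ (as a function of $n$) is $\max(|c|,|d|)$.
   Context: A one-move rider has a single basic move $(c,d)\in\mathbb Z^2\setminus\{0\}$ with $\gcd(c,d)=1$. Two pieces at positions $z,z'\in\mathbb Z^2$ attack each other if $z'-z$ is an integer multiple (possibly zero) of $(c,d)$. $u_{\mathsf P}(q;n)$ is the number of ways to place $q$ unlabelled pieces on the $n\times n$ board $\{1,\dots,n\}^2$ so that no two attack each other; it is a quasipolynomial in $n$, i.e. there is $p\ge1$ and polynomials $f_0,\dots,f_{p-1}$ with $u_{\mathsf P}(q;n)=f_{n\bmod p}(n)$ for all $n$; the period is the least such $p$. *)

theory Defs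
  imports Complex_Main "HOL-Computational_Algebra.Polynomial"
begin

definition attacks :: "int \<times> int \<Rightarrow> int \<times> int \<Rightarrow> int \<times> int \<Rightarrow> bool" where
  "attacks m z z' \<longleftrightarrow>
     (\<exists>k::int. fst z' - fst z = k * fst m \<and> snd z' - snd z = k * snd m)"

definition square_board :: "nat \<Rightarrow> (int \<times> int) set" where
  "square_board n = {1..int n} \<times> {1..int n}"

(* Pieces on the same square attack each other (k = 0), so a nonattacking placement
   of q unlabelled pieces is a set of exactly q squares. *)
definition nonattacking_placements :: "int \<times> int \<Rightarrow> nat \<Rightarrow> nat \<Rightarrow> (int \<times> int) set set" where
  "nonattacking_placements m q n =
     {S. S \<subseteq> square_board n \<and> card S = q \<and> pairwise (\<lambda>z z'. \<not> attacks m z z') S}"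

definition num_placements :: "int \<times> int \<Rightarrow> nat \<Rightarrow> nat \<Rightarrow> nat" where
  "num_placements m q n = card (nonattacking_placements m q n)"

definition quasipolynomial_with :: "nat \<Rightarrow> (nat \<Rightarrow> real) \<Rightarrow> bool" where
  "quasipolynomial_with p u \<longleftrightarrow>
     p \<ge> 1 \<and> (\<exists>f :: nat \<Rightarrow> real poly. \<forall>n. u n = poly (f (n mod p)) (real n))"

definition quasipolynomial :: "(nat \<Rightarrow> real) \<Rightarrow> bool" where
  "quasipolynomial u \<longleftrightarrow> (\<exists>p. quasipolynomial_with p u)"

(* Meaningful only when u is a quasipolynomial. *)
definition quasi_period :: "(nat \<Rightarrow> real) \<Rightarrow> nat" where
  "quasi_period u = (LEAST p. quasipolynomial_with p u)"

end

theory Submission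
  imports Defs
begin

text \<open>
  By symmetry assume \<open>0 \<le> c \<le> d\<close>. Attacking is an equivalence relation whose classes on the board are
  chains, so a nonattacking placement picks one square from each of \<open>q\<close> distinct chains, and
  the count is the \<open>q\<close>-th elementary symmetric function of the chain lengths. Newton's recursion
  expresses it through the power sums of the lengths. Write \<open>n = t d + s\<close> with \<open>0 \<le> s < d\<close>; the
  number of \<open>z\<close> such that \<open>z\<close> and \<open>z + k (c, d)\<close> both lie on the board is \<open>(n - k c) (n - k d)\<close> for
  \<open>k \<le> t\<close> and \<open>0\<close> afterwards, whence the power sums are polynomials in \<open>n\<close> for each fixed \<open>s\<close>, and
  \<open>d\<close> is a period.

  For minimality, let \<open>y = n / d\<close> and \<open>\<sigma> = s / d\<close>. The \<open>r\<close>-th power sum has degree \<open>r + 1\<close> in \<open>y\<close>, but its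
  dependence on \<open>\<sigma>\<close> only starts in degree \<open>r - 1\<close>; the first power sum \<open>n\<^sup>2\<close> does not depend on \<open>\<sigma>\<close> at all, and
  the second one differs from its value at \<open>\<sigma> = 0\<close> by \<open>d (d - c) \<sigma> (1 - \<sigma>) y\<close> up to a constant. Through
  the recursion, the constituents for \<open>\<sigma>\<close> and for \<open>0\<close> differ in the coefficient of \<open>y^(2 q - 3)\<close>. A
  period \<open>p < d\<close> would force the constituents of the residues \<open>0\<close> and \<open>p\<close> to agree.
\<close>

subsection \<open>Independent sets of an equivalence relation\<close>

definition independent_sets :: "('a \<Rightarrow> 'a \<Rightarrow> bool) \<Rightarrow> nat \<Rightarrow> 'a set \<Rightarrow> 'a set set" where
  "independent_sets E q B = {S. S \<subseteq> B \<and> card S = q \<and> pairwise (\<lambda>z z'. \<not> E z z') S}"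

lemma finite_independent_sets: "finite B \<Longrightarrow> finite (independent_sets E q B)"
  by (rule finite_subset[of _ "Pow B"]) (auto simp: independent_sets_def)

lemma independent_sets_0: "finite B \<Longrightarrow> independent_sets E 0 B = {{}}"
  by (auto simp: independent_sets_def card_eq_0_iff dest: finite_subset)

text \<open>As \<open>E z w\<close> holds, deleting the class of \<open>z\<close> also deletes the
  class of \<open>w\<close>. The split below needs an arbitrary \<open>w\<close> in the class, the
  double count only \<open>w = z\<close>.\<close>

lemma insert_independent:
  assumes "equivp E" "finite B" "z \<in> B" "w \<in> B" "E z w"
    "S \<in> independent_sets E q (B - {w \<in> B. E z w})"
  shows "insert w S \<in> independent_sets E (Suc q) B" "w \<notin> S"
proof -
  have S: "S \<subseteq> B - {w \<in> B. E z w}" "card S = q" "pairwise (\<lambda>z z'. \<not> E z z') S"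
    using assms(6) by (auto simp: independent_sets_def)
  have fin: "finite S" using S(1) assms(2) by (meson finite_Diff finite_subset)
  show w: "w \<notin> S" using S assms by auto
  have "\<not> E w v \<and> \<not> E v w" if "v \<in> S" for v
  proof -
    have "\<not> E z v" using that S by auto
    then show ?thesis using assms(1,5) by (meson equivp_symp equivp_transp)
  qed
  then show "insert w S \<in> independent_sets E (Suc q) B"
    using S w fin assms(4) by (auto simp: independent_sets_def pairwise_insert)
qed

lemma remove_independent:
  assumes "equivp E" "finite B" "z \<in> B" "w \<in> S" "E z w" "S \<in> independent_sets E (Suc q) B"
  shows "S - {w} \<in> independent_sets E q (B - {w \<in> B. E z w})"
proof -
  have S: "S \<subseteq> B" "card S = Suc q" "pairwise (\<lambda>z z'. \<not> E z z') S"
    using assms(6) by (auto simp: independent_sets_def)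
  have "\<not> E z v" if "v \<in> S - {w}" for v
    using that S(3) assms(1,4,5) by (metis DiffD1 DiffD2 equivp_symp equivp_transp insertI1 pairwiseD)
  then show ?thesis
    using S assms(4) by (auto simp: independent_sets_def intro: pairwise_subset)
qed

text \<open>An independent set meets a class at most once: it either avoids \<open>C\<close> or
  arises uniquely from one \<open>w\<close> in \<open>C\<close> and an independent set outside
  \<open>C\<close>.\<close>

lemma card_independent_split:
  assumes "equivp E" "finite B" "z \<in> B"
  defines "C \<equiv> {w \<in> B. E z w}"
  shows "card (independent_sets E (Suc q) B) =
    card (independent_sets E (Suc q) (B - C)) + card C * card (independent_sets E q (B - C))"
proof -
  let ?h = "\<lambda>(w, S). insert w S"
  let ?X = "C \<times> independent_sets E q (B - C)"
  have inj: "inj_on ?h ?X"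
  proof (rule inj_onI, clarify)
    fix w S v T
    assume *: "w \<in> C" "S \<in> independent_sets E q (B - C)" "v \<in> C" "T \<in> independent_sets E q (B - C)"
      "insert w S = insert v T"
    have "w \<notin> S" "w \<notin> T" "v \<notin> S" "v \<notin> T"
      using * unfolding C_def by (auto simp: independent_sets_def)
    then show "w = v \<and> S = T" using *(5) by (metis insert_iff insert_ident)
  qed
  have "independent_sets E (Suc q) B = independent_sets E (Suc q) (B - C) \<union> ?h ` ?X"
  proof (intro equalityI subsetI)
    fix S assume S: "S \<in> independent_sets E (Suc q) B"
    show "S \<in> independent_sets E (Suc q) (B - C) \<union> ?h ` ?X"
    proof (cases "S \<inter> C = {}")
      case True
      then show ?thesis using S by (auto simp: independent_sets_def)
    next
      case False
      then obtain w where w: "w \<in> S" "w \<in> C" by auto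
      then have "S - {w} \<in> independent_sets E q (B - C)"
        using remove_independent[OF assms(1-3), of w S q] S by (auto simp: C_def)
      then have "?h (w, S - {w}) \<in> ?h ` ?X" using w by blast
      then show ?thesis using w by (simp add: insert_absorb)
    qed
  next
    fix S assume "S \<in> independent_sets E (Suc q) (B - C) \<union> ?h ` ?X"
    then show "S \<in> independent_sets E (Suc q) B"
    proof
      assume "S \<in> ?h ` ?X"
      then show ?thesis
        using insert_independent(1)[OF assms(1-3)] by (auto simp: C_def)
    qed (auto simp: independent_sets_def)
  qed
  moreover have "independent_sets E (Suc q) (B - C) \<inter> ?h ` ?X = {}"
    by (auto simp: independent_sets_def)
  moreover have "finite C" using assms(2) by (simp add: C_def)
  ultimately show ?thesis
    using assms(2) inj
    by (simp add: card_Un_disjoint finite_independent_sets card_image)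
qed

text \<open>Both sides count the pairs of an independent set and one of its elements.\<close>
lemma card_independent_Suc:
  assumes "equivp E" "finite B"
  shows "Suc q * card (independent_sets E (Suc q) B) =
    (\<Sum>z\<in>B. card (independent_sets E q (B - {w \<in> B. E z w})))"
proof -
  let ?I = "independent_sets E (Suc q) B"
  have E_refl: "E z z" for z using assms(1) by (simp add: equivp_reflp)
  have "card (independent_sets E q (B - {w \<in> B. E z w})) = card {S \<in> ?I. z \<in> S}" if z: "z \<in> B" for z
  proof (rule bij_betw_same_card[of "insert z"], rule bij_betw_byWitness[where f' = "\<lambda>S. S - {z}"])
    show "\<forall>S\<in>independent_sets E q (B - {w \<in> B. E z w}). insert z S - {z} = S"
      using insert_independent(2)[OF assms z z E_refl] by blast
    show "insert z ` independent_sets E q (B - {w \<in> B. E z w}) \<subseteq> {S \<in> ?I. z \<in> S}"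
      using insert_independent(1)[OF assms z z E_refl] by auto
    show "(\<lambda>S. S - {z}) ` {S \<in> ?I. z \<in> S} \<subseteq> independent_sets E q (B - {w \<in> B. E z w})"
      using remove_independent[OF assms z _ E_refl] by auto
  qed auto
  then have "(\<Sum>z\<in>B. card (independent_sets E q (B - {w \<in> B. E z w}))) = (\<Sum>z\<in>B. card {S \<in> ?I. z \<in> S})"
    by simp
  also have "\<dots> = (\<Sum>z\<in>B. \<Sum>S | S \<in> ?I \<and> z \<in> S. 1)" by simp
  also have "\<dots> = (\<Sum>S\<in>?I. \<Sum>z | z \<in> B \<and> z \<in> S. 1)"
    by (rule sum.swap_restrict) (use assms finite_independent_sets in auto)
  also have "\<dots> = (\<Sum>S\<in>?I. Suc q)"
  proof (rule sum.cong[OF refl])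
    fix S assume "S \<in> ?I"
    then have "{z. z \<in> B \<and> z \<in> S} = S" "card S = Suc q" by (auto simp: independent_sets_def)
    then show "(\<Sum>z | z \<in> B \<and> z \<in> S. 1) = Suc q" by simp
  qed
  finally show ?thesis by simp
qed

text \<open>
  \<open>P r\<close> stands for the sum of \<open>(card (class of z)) ^ r\<close> over all elements \<open>z\<close>, that is, the power sum of
  exponent \<open>r + 1\<close> of the class sizes.
\<close>
fun newton_poly :: "(nat \<Rightarrow> real poly) \<Rightarrow> nat \<Rightarrow> nat \<Rightarrow> real poly" where
  "newton_poly P 0 r = P r"
| "newton_poly P (Suc q) r = smult (1 / real (Suc q)) (P r * newton_poly P q 0) - newton_poly P q (Suc r)"

text \<open>Multiply the split by the \<open>r\<close>-th power of the class size and sum over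
  \<open>z\<close>: the last term becomes the instance \<open>Suc r\<close> of the previous level.
  The instance \<open>r = 0\<close> of that level is the double count, which supplies the number of
  independent sets of size \<open>Suc q\<close>.\<close>

lemma poly_newton_poly:
  assumes "equivp E" "finite B"
    and P: "\<And>r. poly (P r) x = (\<Sum>z\<in>B. real (card {w \<in> B. E z w}) ^ r)"
  shows "poly (newton_poly P q r) x =
    (\<Sum>z\<in>B. real (card {w \<in> B. E z w}) ^ r * real (card (independent_sets E q (B - {w \<in> B. E z w}))))"
proof (induction q arbitrary: r)
  case 0
  then show ?case using assms(2) by (simp add: P independent_sets_0)
next
  case (Suc q)
  let ?C = "\<lambda>z. {w \<in> B. E z w}"
  let ?u = "\<lambda>q B. real (card (independent_sets E q B))"
  have "real (Suc q) * ?u (Suc q) B = (\<Sum>z\<in>B. ?u q (B - ?C z))"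
    using arg_cong[OF card_independent_Suc[OF assms(1,2)], of real q] by (simp only: of_nat_mult of_nat_sum)
  then have u: "poly (newton_poly P q 0) x = real (Suc q) * ?u (Suc q) B"
    by (simp add: Suc.IH)
  have s: "?u (Suc q) (B - ?C z) = ?u (Suc q) B - real (card (?C z)) * ?u q (B - ?C z)" if "z \<in> B" for z
    using card_independent_split[OF assms(1,2) that, of q] by simp
  have "(\<Sum>z\<in>B. real (card (?C z)) ^ r * ?u (Suc q) (B - ?C z)) =
    (\<Sum>z\<in>B. real (card (?C z)) ^ r * ?u (Suc q) B - real (card (?C z)) ^ Suc r * ?u q (B - ?C z))"
    by (intro sum.cong refl) (simp add: s algebra_simps)
  also have "\<dots> = poly (P r) x * ?u (Suc q) B - poly (newton_poly P q (Suc r)) x"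
    by (simp only: sum_subtractf sum_distrib_right P Suc.IH)
  also have "\<dots> = poly (newton_poly P (Suc q) r) x"
    by (simp add: u del: of_nat_Suc)
  finally show ?case by simp
qed

lemma card_independent_eq_poly:
  assumes "equivp E" "finite B"
    and P: "\<And>r. poly (P r) x = (\<Sum>z\<in>B. real (card {w \<in> B. E z w}) ^ r)"
  shows "real (card (independent_sets E (Suc q) B)) = poly (newton_poly P q 0) x / real (Suc q)"
proof -
  have "real (Suc q) * real (card (independent_sets E (Suc q) B)) = poly (newton_poly P q 0) x"
    using arg_cong[OF card_independent_Suc[OF assms(1,2)], of real q]
    by (simp only: of_nat_mult of_nat_sum poly_newton_poly[OF assms(1,2) P] power_0 mult_1)
  then show ?thesis by (metis nonzero_mult_div_cancel_left of_nat_eq_0_iff nat.distinct(2))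
qed

subsection \<open>Lengths of chains on the square board\<close>

lemma equivp_attacks: "equivp (attacks m)"
proof (rule equivpI)
  show "reflp (attacks m)"
    by (rule reflpI) (auto simp: attacks_def intro!: exI[of _ 0])
  show "symp (attacks m)"
  proof (rule sympI)
    fix z w assume "attacks m z w"
    then obtain k where "fst w - fst z = k * fst m" "snd w - snd z = k * snd m"
      by (auto simp: attacks_def)
    then show "attacks m w z"
      by (auto simp: attacks_def algebra_simps intro!: exI[of _ "- k"])
  qed
  show "transp (attacks m)"
  proof (rule transpI)
    fix z w v assume "attacks m z w" "attacks m w v"
    then obtain k l where "fst w - fst z = k * fst m" "snd w - snd z = k * snd m"
      "fst v - fst w = l * fst m" "snd v - snd w = l * snd m"
      by (auto simp: attacks_def)
    then show "attacks m z v"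
      by (auto simp: attacks_def algebra_simps intro!: exI[of _ "k + l"])
  qed
qed

lemma finite_square_board: "finite (square_board n)"
  by (simp add: square_board_def)

definition move :: "int \<times> int \<Rightarrow> int \<Rightarrow> int \<times> int \<Rightarrow> int \<times> int" where
  "move m k z = (fst z + k * fst m, snd z + k * snd m)"

lemma move_0 [simp]: "move m 0 z = z"
  by (simp add: move_def)

lemma move_move [simp]: "move m k (move m l z) = move m (k + l) z"
  by (simp add: move_def algebra_simps)

lemma attacks_iff_move: "attacks m z w \<longleftrightarrow> (\<exists>k. w = move m k z)"
  by (auto simp: attacks_def move_def prod_eq_iff algebra_simps)

lemma move_eq_iff: "snd m > 0 \<Longrightarrow> move m k z = move m l z \<longleftrightarrow> k = l"
  by (auto simp: move_def)

lemma inj_move: "inj (move m k)"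
  by (rule injI) (auto simp: move_def prod_eq_iff)

text \<open>The board is a box, and both coordinates are monotone in \<open>k\<close> because the
  move has nonnegative components.\<close>

lemma move_in_board_between:
  assumes "move m j z \<in> square_board n" "move m l z \<in> square_board n" "j \<le> k" "k \<le> l"
    "0 \<le> fst m" "0 \<le> snd m"
  shows "move m k z \<in> square_board n"
proof -
  have "j * fst m \<le> k * fst m" "k * fst m \<le> l * fst m" "j * snd m \<le> k * snd m" "k * snd m \<le> l * snd m"
    using assms by (auto intro: mult_right_mono)
  then show ?thesis using assms(1,2) by (auto simp: square_board_def move_def)
qed

text \<open>This crude bound ensures that the minima defining \<open>chain_length\<close> and the
  backward walk in \<open>bij_betw_chains\<close> are attained.\<close>

lemma move_leaves_board:
  assumes "z \<in> square_board n" "1 \<le> snd m"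
  shows "move m (int n) z \<notin> square_board n" "move m (- int n) z \<notin> square_board n"
proof -
  define a where "a = int n * snd m"
  have "int n * 1 \<le> int n * snd m" using assms by (intro mult_left_mono) auto
  then have "int n \<le> a" by (simp add: a_def)
  moreover have "snd (move m (int n) z) = snd z + a" "snd (move m (- int n) z) = snd z - a"
    by (simp_all add: move_def a_def)
  ultimately show "move m (int n) z \<notin> square_board n" "move m (- int n) z \<notin> square_board n"
    using assms(1) by (auto simp: square_board_def mem_Times_iff)
qed

lemma card_board_inter_move:
  assumes "0 \<le> c" "0 \<le> d"
  shows "card {z \<in> square_board n. move (c, d) (int k) z \<in> square_board n} =
    nat (int n - int k * c) * nat (int n - int k * d)"
proof -
  have "0 \<le> int k * c" "0 \<le> int k * d" using assms by auto
  then have "{z \<in> square_board n. move (c, d) (int k) z \<in> square_board n} =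
    {1..int n - int k * c} \<times> {1..int n - int k * d}"
    by (auto simp: square_board_def move_def)
  then show ?thesis by (simp add: card_cartesian_product)
qed

section \<open>Partition of the board into chains\<close>

definition chain_length :: "int \<times> int \<Rightarrow> nat \<Rightarrow> int \<times> int \<Rightarrow> nat" where
  "chain_length m n z = (LEAST k. move m (int k) z \<notin> square_board n)"

definition chain_starts :: "int \<times> int \<Rightarrow> nat \<Rightarrow> (int \<times> int) set" where
  "chain_starts m n = {z \<in> square_board n. move m (- 1) z \<notin> square_board n}"

lemma less_chain_length_iff:
  assumes "z \<in> square_board n" "0 \<le> fst m" "1 \<le> snd m"
  shows "k < chain_length m n z \<longleftrightarrow> move m (int k) z \<in> square_board n"
proof
  show "k < chain_length m n z \<Longrightarrow> move m (int k) z \<in> square_board n"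
    unfolding chain_length_def using not_less_Least by blast
  assume k: "move m (int k) z \<in> square_board n"
  have "move m (int (chain_length m n z)) z \<notin> square_board n"
    unfolding chain_length_def by (rule LeastI, rule move_leaves_board) (use assms in auto)
  then show "k < chain_length m n z"
    using move_in_board_between[of m 0 z n "int k" "int (chain_length m n z)"] k assms by force
qed

text \<open>Each square has a unique chain start and a unique distance from it, so sums over squares
  become sums over starts.\<close>

lemma bij_betw_chains:
  assumes "0 \<le> fst m" "1 \<le> snd m"
  shows "bij_betw (\<lambda>(i, k). move m (int k) i)
    (SIGMA i:chain_starts m n. {..<chain_length m n i}) (square_board n)"
proof (rule bij_betw_imageI)
  let ?f = "\<lambda>(i, k). move m (int k) i"
  let ?X = "SIGMA i:chain_starts m n. {..<chain_length m n i}"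
  have start: "i \<in> square_board n" "move m (- 1) i \<notin> square_board n" if "i \<in> chain_starts m n" for i
    using that by (auto simp: chain_starts_def)
  \<comment> \<open>If \<open>k > l\<close>, then \<open>j\<close> is reached from \<open>i\<close>
    by at least one move, so the predecessor of \<open>j\<close> is on the board and
    \<open>j\<close> is no start. Used in both directions, this yields \<open>k = l\<close>.\<close>
  have le: "k \<le> l" if "i \<in> chain_starts m n" "j \<in> chain_starts m n" "move m (int k) i = move m (int l) j"
    for i j k l
  proof (rule ccontr)
    assume "\<not> k \<le> l"
    have "j = move m (- int l) (move m (int l) j)" by simp
    also have "\<dots> = move m (- int l + int k) i" by (simp only: that(3)[symmetric] move_move)
    finally have "move m (- 1) j = move m (int k - int l - 1) i" "j = move m (int k - int l) i"
      by (simp_all add: algebra_simps)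
    then show False
      using move_in_board_between[of m 0 i n "int k - int l" "int k - int l - 1"]
        start(1)[OF that(1)] start(1)[OF that(2)] start(2)[OF that(2)] \<open>\<not> k \<le> l\<close> assms by simp
  qed
  show "inj_on ?f ?X"
  proof (rule inj_onI, clarify)
    fix i k j l
    assume *: "i \<in> chain_starts m n" "j \<in> chain_starts m n" "move m (int k) i = move m (int l) j"
    then have "k = l" using le[of i j k l] le[of j i l k] by simp
    then show "i = j \<and> k = l" using *(3) injD[OF inj_move] by blast
  qed
  show "?f ` ?X = square_board n"
  proof (intro equalityI subsetI)
    fix z assume "z \<in> ?f ` ?X"
    then obtain i k where "i \<in> chain_starts m n" "k < chain_length m n i" "z = move m (int k) i"
      by auto
    then show "z \<in> square_board n" using less_chain_length_iff[of i n m k] assms start by auto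
  next
    fix z assume z: "z \<in> square_board n"
    \<comment> \<open>Walk back as far as possible: \<open>Suc k\<close> is the first number of
      backward steps that leaves the board, so \<open>k\<close> steps still stay on it, also when
      \<open>k = 0\<close>.\<close>
    define k where "k = (LEAST k. move m (- int (Suc k)) z \<notin> square_board n)"
    have "n \<noteq> 0" using z by (auto simp: square_board_def)
    then have ex: "move m (- int (Suc (n - 1))) z \<notin> square_board n"
      using move_leaves_board(2)[OF z assms(2)] by simp
    have k1: "move m (- int (Suc k)) z \<notin> square_board n"
      unfolding k_def by (rule LeastI[of "\<lambda>k. move m (- int (Suc k)) z \<notin> square_board n", OF ex])
    have k0: "move m (- int k) z \<in> square_board n"
    proof (cases k)
      case (Suc l)
      then have "l < k" by simp
      then show ?thesis
        using Suc not_less_Least[of l "\<lambda>k. move m (- int (Suc k)) z \<notin> square_board n"] by (simp add: k_def)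
    qed (use z in simp)
    let ?i = "move m (- int k) z"
    have i: "?i \<in> chain_starts m n" using k0 k1 by (simp add: chain_starts_def algebra_simps)
    have "k < chain_length m n ?i" using less_chain_length_iff[of ?i n m k] k0 z assms by simp
    then have "(?i, k) \<in> ?X" using i by simp
    moreover have "z = ?f (?i, k)" by simp
    ultimately show "z \<in> ?f ` ?X" by blast
  qed
qed

text \<open>\<open>chain_length\<close> only counts squares from its argument onwards; for a start
  \<open>i\<close> this is the whole attack class of every square on the chain.\<close>

lemma card_chain:
  assumes "0 \<le> fst m" "1 \<le> snd m" "i \<in> chain_starts m n" "k < chain_length m n i"
  shows "card {w \<in> square_board n. attacks m (move m (int k) i) w} = chain_length m n i"
proof -
  have i: "i \<in> square_board n" "move m (- 1) i \<notin> square_board n"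
    using assms(3) by (auto simp: chain_starts_def)
  have "{w \<in> square_board n. attacks m (move m (int k) i) w} =
    (\<lambda>l. move m (int l) i) ` {..<chain_length m n i}"
  proof (intro equalityI subsetI)
    fix w assume w: "w \<in> {w \<in> square_board n. attacks m (move m (int k) i) w}"
    then obtain l where l: "w = move m l (move m (int k) i)" by (auto simp: attacks_iff_move)
    have "0 \<le> l + int k"
    proof (rule ccontr)
      assume "\<not> 0 \<le> l + int k"
      then show False
        using move_in_board_between[of m "l + int k" i n 0 "- 1"] l w i assms(1,2) by simp
    qed
    then obtain j where "l + int k = int j" using zero_le_imp_eq_int by blast
    then have "w = move m (int j) i" using l by simp
    moreover from this have "j < chain_length m n i"
      using w less_chain_length_iff[OF i(1) assms(1,2)] by simp
    ultimately show "w \<in> (\<lambda>l. move m (int l) i) ` {..<chain_length m n i}" by auto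
  next
    fix w assume "w \<in> (\<lambda>l. move m (int l) i) ` {..<chain_length m n i}"
    then obtain l where l: "w = move m (int l) i" "l < chain_length m n i" by auto
    moreover have "w = move m (int l - int k) (move m (int k) i)" using l by simp
    ultimately show "w \<in> {w \<in> square_board n. attacks m (move m (int k) i) w}"
      using less_chain_length_iff[OF i(1) assms(1,2)] unfolding attacks_iff_move by blast
  qed
  moreover have "inj_on (\<lambda>l. move m (int l) i) {..<chain_length m n i}"
    using assms(2) by (auto simp: inj_on_def move_eq_iff)
  ultimately show ?thesis by (simp add: card_image)
qed

text \<open>A square of \<open>?D k\<close> has its predecessor on the board exactly when that
  predecessor lies in \<open>?D (Suc k)\<close>. Removing the translate of \<open>?D (Suc k)\<close>
  leaves the starts, so their number is a difference of two rectangle sizes.\<close>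

lemma card_chain_starts_longer:
  assumes "0 \<le> c" "1 \<le> d"
  shows "real (card {i \<in> chain_starts (c, d) n. k < chain_length (c, d) n i}) =
    real (nat (int n - int k * c) * nat (int n - int k * d)) -
    real (nat (int n - int (Suc k) * c) * nat (int n - int (Suc k) * d))"
proof -
  let ?m = "(c, d)" let ?B = "square_board n"
  let ?D = "\<lambda>k. {z \<in> ?B. move ?m (int k) z \<in> ?B}"
  have *: "{i \<in> chain_starts ?m n. k < chain_length ?m n i} = ?D k - move ?m 1 ` ?D (Suc k)"
  proof (intro equalityI subsetI)
    fix i assume "i \<in> {i \<in> chain_starts ?m n. k < chain_length ?m n i}"
    then have "i \<in> ?B" "move ?m (- 1) i \<notin> ?B" "move ?m (int k) i \<in> ?B"
      using less_chain_length_iff[of i n ?m k] assms by (auto simp: chain_starts_def)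
    then show "i \<in> ?D k - move ?m 1 ` ?D (Suc k)" by auto
  next
    fix i assume i: "i \<in> ?D k - move ?m 1 ` ?D (Suc k)"
    have "move ?m (- 1) i \<notin> ?B"
    proof
      assume "move ?m (- 1) i \<in> ?B"
      then have "move ?m (- 1) i \<in> ?D (Suc k)" using i by simp
      then have "move ?m 1 (move ?m (- 1) i) \<in> move ?m 1 ` ?D (Suc k)" by (rule imageI)
      then show False using i by simp
    qed
    then show "i \<in> {i \<in> chain_starts ?m n. k < chain_length ?m n i}"
      using i less_chain_length_iff[of i n ?m k] assms by (auto simp: chain_starts_def)
  qed
  have sub: "move ?m 1 ` ?D (Suc k) \<subseteq> ?D k"
  proof (rule image_subsetI)
    fix z assume "z \<in> ?D (Suc k)"
    then show "move ?m 1 z \<in> ?D k"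
      using move_in_board_between[of ?m 0 z n "int (Suc k)" 1] assms by (simp add: add.commute)
  qed
  have fin: "finite (?D k)" for k using finite_square_board by simp
  have card: "card (move ?m 1 ` ?D (Suc k)) = card (?D (Suc k))"
    by (rule card_image) (meson inj_move inj_on_subset subset_UNIV)
  have "card (?D k - move ?m 1 ` ?D (Suc k)) = card (?D k) - card (move ?m 1 ` ?D (Suc k))"
    by (rule card_Diff_subset[OF finite_subset[OF sub fin] sub])
  then have "card {i \<in> chain_starts ?m n. k < chain_length ?m n i} = card (?D k) - card (?D (Suc k))"
    using * card by simp
  moreover have "card (?D (Suc k)) \<le> card (?D k)"
    using card_mono[OF fin sub] card by simp
  ultimately show ?thesis
    using assms by (simp add: of_nat_diff card_board_inter_move del: of_nat_mult of_nat_Suc)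
qed

section \<open>Power sums of the chain lengths by partial summation\<close>

lemma summation_by_parts_quadratic:
  fixes n c d :: real and \<psi> :: "nat \<Rightarrow> real"
  defines "W \<equiv> \<lambda>k::nat. (n - real k * c) * (n - real k * d)"
  assumes "\<psi> 0 = 0"
  shows "(\<Sum>k<t. (\<psi> (Suc k) - \<psi> k) * (W k - W (Suc k))) + (\<psi> (Suc t) - \<psi> t) * W t =
    2 * c * d * (\<Sum>k=1..t. \<psi> k) + \<psi> (Suc t) * W t - \<psi> t * W (Suc t)"
proof (induction t)
  case (Suc t)
  \<comment> \<open>\<open>W\<close> is quadratic in its index with leading coefficient
    \<open>c * d\<close>, so its second difference is the constant \<open>2 * c * d\<close>.\<close>
  have "W t - W (Suc t) = W (Suc t) - W (Suc (Suc t)) + 2 * c * d"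
    by (simp add: W_def algebra_simps)
  then have "\<psi> (Suc t) * (W t - W (Suc t)) = \<psi> (Suc t) * (W (Suc t) - W (Suc (Suc t)) + 2 * c * d)"
    by simp
  with Suc show ?case by (simp add: algebra_simps)
qed (simp add: assms)

text \<open>A chain of length \<open>l\<close> contributes \<open>l * l ^ r\<close>. Partial
  summation leaves two boundary terms, which factor through \<open>n - t * d = s\<close> and
  \<open>(t + 1) * d - n = d - s\<close>.\<close>

lemma sum_card_chain_power:
  fixes c d :: int and n :: nat and s :: real
  assumes "0 \<le> c" "c \<le> d" "1 \<le> d"
  defines "t \<equiv> n div nat d" and "s \<equiv> real (n mod nat d)"
  shows "(\<Sum>z\<in>square_board n. real (card {w \<in> square_board n. attacks (c, d) z w}) ^ r) =
    2 * real_of_int c * real_of_int d * (\<Sum>k=1..t. real k ^ Suc r)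
    + s * (real n - real t * c) * real (Suc t) ^ Suc r
    + (d - s) * (real n - real (Suc t) * c) * real t ^ Suc r"
proof -
  let ?m = "(c, d)" let ?B = "square_board n" let ?I = "chain_starts ?m n" let ?l = "chain_length ?m n"
  let ?W = "\<lambda>k::nat. (real n - real k * c) * (real n - real k * d)"
  let ?\<psi> = "\<lambda>k. real k ^ Suc r"
  have m: "0 \<le> fst ?m" "1 \<le> snd ?m" using assms by auto
  have finI: "finite ?I" using finite_square_board by (simp add: chain_starts_def)
  have n: "real n = real t * d + s"
  proof -
    have "n = t * nat d + n mod nat d" by (simp add: t_def)
    then have "real n = real t * real (nat d) + s" by (metis of_nat_add of_nat_mult s_def)
    then show ?thesis using assms by simp
  qed
  have s: "0 \<le> s" "s < d"
  proof -
    have "n mod nat d < nat d" using assms by simp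
    then show "s < d" using assms unfolding s_def by linarith
  qed (simp add: s_def)
  have ni: "int n = int t * d + int (n mod nat d)"
    using n unfolding s_def by (metis (mono_tags, opaque_lifting) of_int_add of_int_eq_iff of_int_mult of_int_of_nat_eq)
  have smod: "int (n mod nat d) < d"
    using s unfolding s_def by linarith
  have len: "?l i \<le> Suc t" if "i \<in> ?I" for i
  proof (rule ccontr)
    assume "\<not> ?l i \<le> Suc t"
    then have "move ?m (int (Suc t)) i \<in> ?B"
      using less_chain_length_iff[of i n ?m "Suc t"] that m by (simp add: chain_starts_def)
    then have "snd i + int (Suc t) * d \<le> int n" "1 \<le> snd i"
      using that by (auto simp: chain_starts_def square_board_def move_def)
    then show False using ni smod by (simp add: algebra_simps)
  qed
  \<comment> \<open>Up to \<open>t\<close> both factors are nonnegative because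
    \<open>c <= d\<close>, so \<open>nat\<close> truncates nothing. At \<open>Suc t\<close> the
    count is 0 while \<open>?W (Suc t)\<close> need not vanish; hence the separate last summand
    below.\<close>
  have N: "real (nat (int n - int k * c) * nat (int n - int k * d)) = ?W k" if "k \<le> t" for k
  proof -
    have "int k * d \<le> int t * d" "int k * c \<le> int k * d"
      using that assms by (auto intro: mult_right_mono mult_left_mono)
    then have "0 \<le> int n - int k * c" "0 \<le> int n - int k * d" using ni by linarith+
    then show ?thesis by simp
  qed
  have N0: "nat (int n - int (Suc t) * d) = 0"
    using ni smod by (simp add: algebra_simps)
  have "(\<Sum>z\<in>?B. real (card {w \<in> ?B. attacks ?m z w}) ^ r) =
    (\<Sum>(i, k)\<in>(SIGMA i:?I. {..<?l i}). real (card {w \<in> ?B. attacks ?m (move ?m (int k) i) w}) ^ r)"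
    by (subst sum.reindex_bij_betw[OF bij_betw_chains[OF m], symmetric]) (simp add: case_prod_unfold)
  also have "\<dots> = (\<Sum>(i, k)\<in>(SIGMA i:?I. {..<?l i}). real (?l i) ^ r)"
  proof (rule sum.cong[OF refl], clarify)
    fix i k assume "i \<in> ?I" "k < ?l i"
    then show "real (card {w \<in> ?B. attacks ?m (move ?m (int k) i) w}) ^ r = real (?l i) ^ r"
      using card_chain[OF m] by simp
  qed
  also have "\<dots> = (\<Sum>i\<in>?I. ?\<psi> (?l i))"
    by (subst sum.Sigma[symmetric]) (use finI in auto)
  \<comment> \<open>Telescoping \<open>?\<psi> (?l i)\<close> allows the two sums to be swapped,
    which leaves the number of starts with chains longer than \<open>k\<close>. No chain is longer
    than \<open>Suc t\<close>.\<close>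
  also have "\<dots> = (\<Sum>i\<in>?I. \<Sum>k | k \<in> {..<Suc t} \<and> k < ?l i. ?\<psi> (Suc k) - ?\<psi> k)"
  proof (rule sum.cong[OF refl])
    fix i assume "i \<in> ?I"
    then have "{k. k \<in> {..<Suc t} \<and> k < ?l i} = {..<?l i}" using len[of i] by auto
    then show "?\<psi> (?l i) = (\<Sum>k | k \<in> {..<Suc t} \<and> k < ?l i. ?\<psi> (Suc k) - ?\<psi> k)"
      using sum_lessThan_telescope[of ?\<psi> "?l i"] by simp
  qed
  also have "\<dots> = (\<Sum>k<Suc t. \<Sum>i | i \<in> ?I \<and> k < ?l i. ?\<psi> (Suc k) - ?\<psi> k)"
    by (rule sum.swap_restrict) (use finI in auto)
  also have "\<dots> = (\<Sum>k<Suc t. (?\<psi> (Suc k) - ?\<psi> k) * real (card {i \<in> ?I. k < ?l i}))"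
    by (simp add: mult.commute)
  also have "\<dots> = (\<Sum>k<t. (?\<psi> (Suc k) - ?\<psi> k) * (?W k - ?W (Suc k))) + (?\<psi> (Suc t) - ?\<psi> t) * ?W t"
  proof -
    have "real (card {i \<in> ?I. k < ?l i}) = ?W k - ?W (Suc k)" if "k < t" for k
      using that N[of k] N[of "Suc k"] assms by (simp only: card_chain_starts_longer less_imp_le Suc_leI)
    moreover have "real (card {i \<in> ?I. t < ?l i}) = ?W t"
      using N[of t] N0 assms by (simp only: card_chain_starts_longer)
    ultimately show ?thesis by simp
  qed
  also have "\<dots> = 2 * real_of_int c * real_of_int d * (\<Sum>k=1..t. ?\<psi> k) + ?\<psi> (Suc t) * ?W t - ?\<psi> t * ?W (Suc t)"
    by (rule summation_by_parts_quadratic) simp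
  also have "\<dots> = 2 * real_of_int c * real_of_int d * (\<Sum>k=1..t. ?\<psi> k) + s * (real n - real t * c) * ?\<psi> (Suc t)
    + (d - s) * (real n - real (Suc t) * c) * ?\<psi> t"
  proof -
    have "?W t = s * (real n - real t * c)" "?W (Suc t) = - ((d - s) * (real n - real (Suc t) * c))"
      using n by (simp_all add: algebra_simps)
    then show ?thesis by (simp add: mult.commute)
  qed
  finally show ?thesis .
qed

subsection \<open>Power sums of the chain lengths as polynomials\<close>

lemma pcompose_shift:
  fixes p :: "real poly"
  assumes "degree p \<le> Suc k"
  shows "coeff (pcompose p [:a, 1:]) (Suc k) = coeff p (Suc k)"
    and "coeff (pcompose p [:a, 1:]) k = coeff p k + real (Suc k) * a * coeff p (Suc k)"
proof -
  have "coeff (pcompose p [:a, 1:]) (Suc k) = coeff p (Suc k) \<and>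
    coeff (pcompose p [:a, 1:]) k = coeff p k + real (Suc k) * a * coeff p (Suc k)"
    using assms
  proof (induction k arbitrary: p)
    case 0
    obtain u p' where p: "p = pCons u p'" by (cases p)
    with 0 have "degree p' = 0" by (auto split: if_splits)
    then obtain v where "p' = [:v:]" by (rule degree_eq_zeroE)
    with p show ?case by (simp add: pcompose_pCons)
  next
    case (Suc k)
    obtain u p' where p: "p = pCons u p'" by (cases p)
    with Suc.prems have d: "degree p' \<le> Suc k" by (auto split: if_splits)
    have "degree (pcompose p' [:a, 1:]) \<le> Suc k" using d by (simp add: degree_pcompose)
    then have "coeff (pcompose p' [:a, 1:]) (Suc (Suc k)) = 0" by (simp add: coeff_eq_0)
    then show ?case using Suc.IH[OF d] p
      by (cases k) (simp_all add: pcompose_pCons mult_pCons_left algebra_simps)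
  qed
  then show "coeff (pcompose p [:a, 1:]) (Suc k) = coeff p (Suc k)"
    and "coeff (pcompose p [:a, 1:]) k = coeff p k + real (Suc k) * a * coeff p (Suc k)"
    by blast+
qed

lemma degree_le_if_coeff_eq_0: "degree p \<le> Suc k \<Longrightarrow> coeff p (Suc k) = 0 \<Longrightarrow> degree p \<le> k"
  by (metis eq_zero_or_degree_less degree_0 le0 le_Suc_eq less_Suc_eq_le)

text \<open>Induction on the degree bound: the backward difference of
  \<open>x ^ (k + 2) / (k + 2)\<close> has leading term \<open>x ^ (k + 1)\<close>, so a multiple of
  that monomial removes the top coefficient of \<open>p\<close>.\<close>

lemma backward_difference_antiderivative:
  fixes p :: "real poly"
  assumes "degree p \<le> k"
  shows "\<exists>S. degree S \<le> Suc k \<and> coeff S (Suc k) = coeff p k / real (Suc k) \<and>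
    poly S 0 = 0 \<and> p = S - pcompose S [:- 1, 1:]"
  using assms
proof (induction k arbitrary: p)
  case 0
  then obtain a where "p = [:a:]" by (metis degree_eq_zeroE le_zero_eq)
  then show ?case by (intro exI[of _ "[:0, a:]"]) (simp add: pcompose_pCons)
next
  case (Suc k)
  define S0 where "S0 = monom (coeff p (Suc k) / real (Suc (Suc k))) (Suc (Suc k))"
  have d0: "degree S0 \<le> Suc (Suc k)" by (simp add: S0_def degree_monom_le)
  let ?D = "S0 - pcompose S0 [:- 1, 1:]"
  have "degree ?D \<le> Suc (Suc k)"
    using d0 by (intro degree_diff_le) (auto simp: degree_pcompose)
  then have "degree ?D \<le> Suc k"
    by (rule degree_le_if_coeff_eq_0) (simp add: pcompose_shift[OF d0])
  then have "degree (p - ?D) \<le> Suc k" by (rule degree_diff_le[OF Suc.prems])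
  then have "degree (p - ?D) \<le> k"
    by (rule degree_le_if_coeff_eq_0) (simp add: pcompose_shift[OF d0], simp add: S0_def field_simps)
  from Suc.IH[OF this] obtain S where S: "degree S \<le> Suc k" "poly S 0 = 0"
    "p - ?D = S - pcompose S [:- 1, 1:]" by blast
  have "coeff S (Suc (Suc k)) = 0" using S(1) by (simp add: coeff_eq_0)
  then have "coeff (S0 + S) (Suc (Suc k)) = coeff p (Suc k) / real (Suc (Suc k))"
    by (simp add: S0_def)
  moreover have "degree (S0 + S) \<le> Suc (Suc k)" using d0 S(1) by (intro degree_add_le) auto
  moreover have "poly (S0 + S) 0 = 0" using S(2) by (simp add: S0_def poly_monom)
  moreover have "p = (S0 + S) - pcompose (S0 + S) [:- 1, 1:]"
    using S(3) by (simp add: pcompose_add algebra_simps)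
  ultimately show ?case by blast
qed

lemma power_sum_poly_exists:
  "\<exists>S :: real poly. degree S \<le> Suc r \<and> coeff S (Suc r) = 1 / real (Suc r) \<and>
    (\<forall>t. poly S (real t) = (\<Sum>k=1..t. real k ^ r))"
proof -
  obtain S where S: "degree S \<le> Suc r" "coeff S (Suc r) = 1 / real (Suc r)" "poly S 0 = 0"
    "monom 1 r = S - pcompose S [:- 1, 1:]"
    using backward_difference_antiderivative[of "monom 1 r" r] by (auto simp: degree_monom_eq)
  have step: "x ^ r = poly S x - poly S (x - 1)" for x
    using arg_cong[OF S(4), of "\<lambda>p. poly p x"] by (simp add: poly_monom poly_pcompose)
  have "poly S (real t) = (\<Sum>k=1..t. real k ^ r)" for t
    by (induction t) (use step[of "real (Suc _)"] in \<open>simp_all add: S(3)\<close>)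
  with S show ?thesis by blast
qed

text \<open>Faulhaber's polynomial, chosen by the properties used later instead of by Bernoulli
  numbers.\<close>

definition power_sum_poly :: "nat \<Rightarrow> real poly" where
  "power_sum_poly r = (SOME S. degree S \<le> Suc r \<and> coeff S (Suc r) = 1 / real (Suc r) \<and>
    (\<forall>t. poly S (real t) = (\<Sum>k=1..t. real k ^ r)))"

lemma power_sum_poly:
  "degree (power_sum_poly r) \<le> Suc r"
  "coeff (power_sum_poly r) (Suc r) = 1 / real (Suc r)"
  "poly (power_sum_poly r) (real t) = (\<Sum>k=1..t. real k ^ r)"
  using someI_ex[OF power_sum_poly_exists[of r]] unfolding power_sum_poly_def by blast+

lemma poly_eq_if_eq_on_infinite:
  fixes p q :: "real poly"
  assumes "infinite X" "\<And>x. x \<in> X \<Longrightarrow> poly p x = poly q x"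
  shows "p = q"
proof (rule ccontr)
  assume "p \<noteq> q"
  then have "finite {x. poly (p - q) x = 0}" by (intro poly_roots_finite) auto
  moreover have "X \<subseteq> {x. poly (p - q) x = 0}" using assms(2) by auto
  ultimately show False using assms(1) finite_subset by blast
qed

text \<open>The explicit form serves the case \<open>r = 1\<close> of \<open>chain_sum_poly\<close>,
  where a coefficient below the two top ones is computed.\<close>

lemma power_sum_poly_2: "power_sum_poly 2 = [:0, 1/6, 1/2, 1/3:]"
proof (rule poly_eq_if_eq_on_infinite[of "range real"])
  show "infinite (range real)" by (simp add: finite_image_iff inj_on_def)
  have "(\<Sum>k=1..t. real k ^ 2) = poly [:0, 1/6, 1/2, 1/3:] (real t)" for t
    by (induction t) (simp_all add: field_simps power2_eq_square)
  then show "poly (power_sum_poly 2) x = poly [:0, 1/6, 1/2, 1/3:] x" if "x \<in> range real" for x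
    using that by (auto simp: power_sum_poly(3))
qed

text \<open>
  The variable is \<open>n / d\<close>, and \<open>\<sigma>\<close> is \<open>(n mod d) / d\<close>, so that \<open>n div d\<close> is the variable minus \<open>\<sigma>\<close>. The
  general formula is also valid for \<open>r = 0\<close>; the separate case makes the independence of \<open>\<sigma>\<close> evident.
\<close>
definition chain_sum_poly :: "real \<Rightarrow> real \<Rightarrow> real \<Rightarrow> nat \<Rightarrow> real poly" where
  "chain_sum_poly c d \<sigma> r = (if r = 0 then [:0, 0, d\<^sup>2:] else
     smult (2 * c * d) (pcompose (power_sum_poly (Suc r)) [:- \<sigma>, 1:])
     + smult (d * \<sigma>) ([:c * \<sigma>, d - c:] * [:1 - \<sigma>, 1:] ^ Suc r)
     + smult (d * (1 - \<sigma>)) ([:c * \<sigma> - c, d - c:] * [:- \<sigma>, 1:] ^ Suc r))"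

lemma poly_chain_sum_poly:
  fixes c d :: int and n :: nat
  assumes "0 \<le> c" "c \<le> d" "1 \<le> d"
  shows "poly (chain_sum_poly c d (real (n mod nat d) / d) r) (real n / d) =
    (\<Sum>z\<in>square_board n. real (card {w \<in> square_board n. attacks (c, d) z w}) ^ r)"
proof (cases "r = 0")
  case True
  then show ?thesis using assms
    by (simp add: chain_sum_poly_def square_board_def card_cartesian_product power2_eq_square)
next
  case False
  define t where "t = n div nat d"
  define s where "s = real (n mod nat d)"
  have "n = t * nat d + n mod nat d" by (simp add: t_def)
  then have "real n = real t * real (nat d) + s" by (metis of_nat_add of_nat_mult s_def)
  then have n: "real n = real t * d + s" using assms by simp
  have t: "real n / d - s / d = real t" using n assms by (simp add: field_simps)
  \<comment> \<open>Substituting \<open>t = n / d - s / d\<close> turns the factors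
    \<open>n - t * c\<close> and \<open>n - (t + 1) * c\<close> into the linear factors of
    \<open>chain_sum_poly\<close>.\<close>
  have e: "c * (s / d) + real n / d * (d - c) = real n - real t * c"
    "c * (s / d) - c + real n / d * (d - c) = real n - real (Suc t) * c"
    using n assms by (simp_all add: field_simps)
  have ds: "d * (s / d) = s" "d * (1 - s / d) = d - s" using assms by (simp_all add: field_simps)
  have "poly (chain_sum_poly c d \<sigma> r) x = 2 * c * d * poly (power_sum_poly (Suc r)) (x - \<sigma>)
    + d * \<sigma> * (c * \<sigma> + x * (d - c)) * (1 + (x - \<sigma>)) ^ Suc r
    + d * (1 - \<sigma>) * (c * \<sigma> - c + x * (d - c)) * (x - \<sigma>) ^ Suc r" for \<sigma> x :: real
  proof -
    have "poly [:1 - \<sigma>, 1:] x = 1 + (x - \<sigma>)" "poly [:- \<sigma>, 1:] x = x - \<sigma>" by simp_all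
    then show ?thesis using False
      by (simp only: chain_sum_poly_def poly_add poly_smult poly_mult poly_power poly_pcompose if_False)
        (simp add: mult.assoc diff_add_eq add_diff_eq)
  qed
  from this[of "s / d" "real n / d"]
  have "poly (chain_sum_poly c d (s / d) r) (real n / d) =
    2 * c * d * poly (power_sum_poly (Suc r)) (real n / d - s / d)
    + s * (c * (s / d) + real n / d * (d - c)) * (1 + (real n / d - s / d)) ^ Suc r
    + (d - s) * (c * (s / d) - c + real n / d * (d - c)) * (real n / d - s / d) ^ Suc r"
    by (simp only: ds)
  then show ?thesis
    unfolding t e power_sum_poly(3) sum_card_chain_power[OF assms]
    by (simp add: t_def s_def)
qed

lemma degree_chain_sum_poly: "degree (chain_sum_poly c d \<sigma> r) \<le> r + 2"
proof -
  have lin: "degree ([:u, v:] * [:a, 1:] ^ Suc r) \<le> r + 2" for u v a :: real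
  proof -
    have "degree ([:a, 1:] ^ Suc r) \<le> Suc r" using degree_power_le[of "[:a, 1:]" "Suc r"] by simp
    moreover have "degree [:u, v:] \<le> 1" by simp
    ultimately show ?thesis using degree_mult_le[of "[:u, v:]" "[:a, 1:] ^ Suc r"] by linarith
  qed
  have "degree (pcompose (power_sum_poly (Suc r)) [:- \<sigma>, 1:]) \<le> r + 2"
    using power_sum_poly(1)[of "Suc r"] by (simp add: degree_pcompose)
  then have "degree (smult (2 * c * d) (pcompose (power_sum_poly (Suc r)) [:- \<sigma>, 1:])
     + smult (d * \<sigma>) ([:c * \<sigma>, d - c:] * [:1 - \<sigma>, 1:] ^ Suc r)
     + smult (d * (1 - \<sigma>)) ([:c * \<sigma> - c, d - c:] * [:- \<sigma>, 1:] ^ Suc r)) \<le> r + 2"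
    by (intro degree_add_le order.trans[OF degree_smult_le] lin)
  then show ?thesis by (simp add: chain_sum_poly_def del: power_Suc)
qed

text \<open>The point is that neither value involves \<sigma>. In the second one the terms with
  factor \<open>R\<close> cancel each other, and the shift of the power sum cancels what remains of
  \<sigma> in the two products.\<close>

lemma coeff_chain_sum_poly:
  assumes "r > 0"
  defines "R \<equiv> Suc r"
  shows "coeff (chain_sum_poly c d \<sigma> r) (Suc R) = 2 * c * d / real (Suc R) + d * (d - c)"
    and "coeff (chain_sum_poly c d \<sigma> r) R = 2 * c * d * coeff (power_sum_poly R) R - c * d"
proof -
  have pow: "coeff ([:a, 1:] ^ R) R = 1" "coeff ([:a, 1:] ^ R) r = real R * a"
    "coeff ([:a, 1:] ^ R) (Suc R) = 0" for a :: real
    using binomial_symmetric[of r R]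
    by (simp_all add: coeff_linear_poly_power coeff_eq_0 degree_linear_power R_def del: power_Suc)
  have lin: "coeff ([:u, v:] * [:a, 1:] ^ R) (Suc R) = v"
    "coeff ([:u, v:] * [:a, 1:] ^ R) R = u + v * real R * a" for u v a :: real
  proof -
    show "coeff ([:u, v:] * [:a, 1:] ^ R) (Suc R) = v"
      using pow[of a] by (simp add: mult_pCons_left)
    have "coeff ([:u, v:] * [:a, 1:] ^ R) (Suc r) = u + v * real R * a"
      using pow(1)[of a, unfolded R_def] pow(2)[of a, unfolded R_def] by (simp add: mult_pCons_left R_def del: power_Suc)
    then show "coeff ([:u, v:] * [:a, 1:] ^ R) R = u + v * real R * a" by (simp only: R_def)
  qed
  have S: "coeff (pcompose (power_sum_poly R) [:a, 1:]) (Suc R) = 1 / real (Suc R)"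
    "coeff (pcompose (power_sum_poly R) [:a, 1:]) R = coeff (power_sum_poly R) R + a" for a
    using power_sum_poly(2)[of R] by (simp_all add: pcompose_shift[OF power_sum_poly(1)] del: of_nat_Suc)
  have P: "chain_sum_poly c d \<sigma> r = smult (2 * c * d) (pcompose (power_sum_poly R) [:- \<sigma>, 1:])
     + smult (d * \<sigma>) ([:c * \<sigma>, d - c:] * [:1 - \<sigma>, 1:] ^ R)
     + smult (d * (1 - \<sigma>)) ([:c * \<sigma> - c, d - c:] * [:- \<sigma>, 1:] ^ R)"
    using assms by (simp add: chain_sum_poly_def)
  show "coeff (chain_sum_poly c d \<sigma> r) (Suc R) = 2 * c * d / real (Suc R) + d * (d - c)"
    unfolding P coeff_add coeff_smult lin S by (simp add: algebra_simps)
  show "coeff (chain_sum_poly c d \<sigma> r) R = 2 * c * d * coeff (power_sum_poly R) R - c * d"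
    unfolding P coeff_add coeff_smult lin S by (simp add: algebra_simps)
qed

lemma degree_chain_sum_poly_diff:
  "degree (chain_sum_poly c d \<sigma> r - chain_sum_poly c d \<tau> r) \<le> r"
proof (cases "r = 0")
  case True
  then show ?thesis by (simp add: chain_sum_poly_def)
next
  case False
  let ?D = "chain_sum_poly c d \<sigma> r - chain_sum_poly c d \<tau> r"
  have "degree ?D \<le> Suc (Suc r)"
    using degree_chain_sum_poly[of c d _ r] by (auto intro: degree_diff_le)
  then have "degree ?D \<le> Suc r"
    by (rule degree_le_if_coeff_eq_0) (use False in \<open>simp add: coeff_chain_sum_poly\<close>)
  then show ?thesis
    by (rule degree_le_if_coeff_eq_0) (use False in \<open>simp add: coeff_chain_sum_poly\<close>)
qed

text \<open>The first trace of \<sigma>: this is positive when \<open>0 < d\<close>,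
  \<open>c < d\<close> and \<open>0 < \<sigma> < 1\<close>, and it drives the proof of
  minimality.\<close>

lemma coeff_chain_sum_poly_1_diff:
  "coeff (chain_sum_poly c d \<sigma> 1 - chain_sum_poly c d 0 1) 1 = d * (d - c) * \<sigma> * (1 - \<sigma>)"
  unfolding chain_sum_poly_def
  by (simp add: power_sum_poly_2[unfolded numeral_2_eq_2] pcompose_pCons) (simp add: algebra_simps)

subsection \<open>Perturbing the power sums in the recursion\<close>

text \<open>The value \<open>a\<close> may be 0, so that sums with cancelling leading terms need no
  case distinction.\<close>

definition top_coeff :: "nat \<Rightarrow> real \<Rightarrow> real poly \<Rightarrow> bool" where
  "top_coeff k a p \<longleftrightarrow> degree p \<le> k \<and> coeff p k = a"

lemma top_coeff_add: "top_coeff k a p \<Longrightarrow> top_coeff k b q \<Longrightarrow> top_coeff k (a + b) (p + q)"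
  by (auto simp: top_coeff_def degree_add_le)

lemma top_coeff_diff: "top_coeff k a p \<Longrightarrow> top_coeff k b q \<Longrightarrow> top_coeff k (a - b) (p - q)"
  by (auto simp: top_coeff_def degree_diff_le)

lemma top_coeff_smult: "top_coeff k a p \<Longrightarrow> top_coeff k (b * a) (smult b p)"
  by (auto simp: top_coeff_def intro: order.trans[OF degree_smult_le])

lemma top_coeff_above: "degree p < k \<Longrightarrow> top_coeff k 0 p"
  by (auto simp: top_coeff_def coeff_eq_0)

lemma top_coeff_mult:
  assumes "top_coeff k a p" "top_coeff l b q"
  shows "top_coeff (k + l) (a * b) (p * q)"
proof -
  have d: "degree p \<le> k" "degree q \<le> l" and ab: "coeff p k = a" "coeff q l = b"
    using assms by (auto simp: top_coeff_def)
  have "coeff (p * q) (k + l) = (\<Sum>i\<le>k + l. coeff p i * coeff q (k + l - i))"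
    by (rule coeff_mult)
  also have "\<dots> = (\<Sum>i\<in>{k}. coeff p i * coeff q (k + l - i))"
  proof (rule sum.mono_neutral_right)
    show "\<forall>i\<in>{..k + l} - {k}. coeff p i * coeff q (k + l - i) = 0"
    proof
      fix i assume "i \<in> {..k + l} - {k}"
      then have "degree p < i \<or> degree q < k + l - i" using d by auto
      then show "coeff p i * coeff q (k + l - i) = 0" by (auto simp: coeff_eq_0)
    qed
  qed auto
  finally have "coeff (p * q) (k + l) = a * b" using ab by simp
  moreover have "degree (p * q) \<le> k + l" using degree_mult_le[of p q] d by simp
  ultimately show ?thesis by (simp add: top_coeff_def)
qed

text \<open>In the recursion only the product reaches the top degree; the subtracted term stays one
  below. For \<open>r > 0\<close> just the degree bound is recorded.\<close>

lemma top_coeff_newton_poly: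
  assumes "\<And>r. degree (P r) \<le> r + 2" "coeff (P 0) 2 = b"
  shows "top_coeff (2 * q + r + 2) (if r = 0 then b ^ Suc q / fact q else coeff (newton_poly P q r) (2 * q + r + 2))
    (newton_poly P q r)"
proof (induction q arbitrary: r)
  case 0
  then show ?case using assms by (auto simp: top_coeff_def numeral_2_eq_2)
next
  case (Suc q)
  have "top_coeff (r + 2) (coeff (P r) (r + 2)) (P r)" using assms(1) by (simp add: top_coeff_def)
  from top_coeff_mult[OF this Suc.IH[of 0]]
  have 1: "top_coeff (2 * Suc q + r + 2) (coeff (P r) (r + 2) * (b ^ Suc q / fact q)) (P r * newton_poly P q 0)"
    by (simp add: algebra_simps)
  have "degree (newton_poly P q (Suc r)) \<le> 2 * q + Suc r + 2" using Suc.IH[of "Suc r"] by (simp only: top_coeff_def)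
  then have 2: "top_coeff (2 * Suc q + r + 2) 0 (newton_poly P q (Suc r))"
    by (intro top_coeff_above) simp
  have *: "top_coeff (2 * Suc q + r + 2) (1 / real (Suc q) * (coeff (P r) (r + 2) * (b ^ Suc q / fact q)) - 0)
    (newton_poly P (Suc q) r)"
    unfolding newton_poly.simps by (rule top_coeff_diff[OF top_coeff_smult[OF 1] 2])
  show ?case
  proof (cases "r = 0")
    case True
    then show ?thesis using * assms(2) by (simp add: numeral_2_eq_2 mult.assoc)
  next
    case False
    then show ?thesis using * by (simp add: top_coeff_def)
  qed
qed

text \<open>\<open>P\<close> and \<open>Q\<close> abstract the power sums for \<sigma> and for 0;
  \<open>b\<close> will be \<open>d ^ 2\<close>, and \<open>a\<close> the coefficient of
  \<open>coeff_chain_sum_poly_1_diff\<close>.\<close>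

context
  fixes P Q :: "nat \<Rightarrow> real poly" and a b :: real
  assumes degP: "\<And>r. degree (P r) \<le> r + 2" and degQ: "\<And>r. degree (Q r) \<le> r + 2"
    and deg_diff: "\<And>r. degree (P r - Q r) \<le> r"
    and eq0: "P 0 = Q 0" and b: "coeff (P 0) 2 = b"
    and a: "coeff (P 1 - Q 1) 1 = a"
begin

lemma newton_poly_Suc_diff:
  "newton_poly P (Suc q) r - newton_poly Q (Suc q) r =
    smult (1 / real (Suc q)) (P r * (newton_poly P q 0 - newton_poly Q q 0) + (P r - Q r) * newton_poly Q q 0)
    - (newton_poly P q (Suc r) - newton_poly Q q (Suc r))"
  unfolding newton_poly.simps
  by (simp add: algebra_simps smult_diff_right smult_add_right del: of_nat_Suc)

text \<open>Two degrees below \<open>newton_poly\<close> itself. As \<open>P 0 = Q 0\<close>, the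
  induction hypothesis at \<open>r = 0\<close> has coefficient 0, so only
  \<open>(P r - Q r) * newton_poly Q q 0\<close> survives at the top. For \<open>r = 0\<close> the
  coefficient vanishes and one degree lower must be examined.\<close>

lemma top_coeff_newton_poly_diff:
  "top_coeff (2 * q + r) (coeff (P r - Q r) r * b ^ q / fact q) (newton_poly P q r - newton_poly Q q r)"
proof (induction q arbitrary: r)
  case 0
  then show ?case using deg_diff by (simp add: top_coeff_def)
next
  case (Suc q)
  have "top_coeff (r + 2) (coeff (P r) (r + 2)) (P r)" using degP by (simp add: top_coeff_def)
  from top_coeff_mult[OF this Suc.IH[of 0]]
  have 1: "top_coeff (2 * Suc q + r) 0 (P r * (newton_poly P q 0 - newton_poly Q q 0))"
    by (simp add: eq0 algebra_simps)
  have "top_coeff r (coeff (P r - Q r) r) (P r - Q r)" using deg_diff by (simp add: top_coeff_def)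
  from top_coeff_mult[OF this top_coeff_newton_poly[OF degQ, of b q 0]]
  have 2: "top_coeff (2 * Suc q + r) (coeff (P r - Q r) r * (b ^ Suc q / fact q)) ((P r - Q r) * newton_poly Q q 0)"
    using b eq0 by (simp add: algebra_simps)
  have "degree (newton_poly P q (Suc r) - newton_poly Q q (Suc r)) \<le> 2 * q + Suc r"
    using Suc.IH[of "Suc r"] by (simp only: top_coeff_def)
  then have 3: "top_coeff (2 * Suc q + r) 0 (newton_poly P q (Suc r) - newton_poly Q q (Suc r))"
    by (intro top_coeff_above) simp
  have "top_coeff (2 * Suc q + r) (1 / real (Suc q) * (0 + coeff (P r - Q r) r * (b ^ Suc q / fact q)) - 0)
    (newton_poly P (Suc q) r - newton_poly Q (Suc q) r)"
    unfolding newton_poly_Suc_diff by (intro top_coeff_diff top_coeff_smult top_coeff_add 1 2 3)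
  then show ?case by (simp add: mult.assoc)
qed

text \<open>
  In the recursion, the term \<open>newton_poly P q 1 - newton_poly Q q 1\<close> contributes a negative amount, and the
  earlier difference, multiplied by \<open>P 0\<close>, a nonpositive one, so no cancellation occurs.
\<close>
lemma coeff_newton_poly_diff_neg:
  assumes "a > 0" "b > 0"
  shows "coeff (newton_poly P (Suc q) 0 - newton_poly Q (Suc q) 0) (2 * q + 1) < 0"
proof -
  have rest: "coeff (newton_poly P q 1 - newton_poly Q q 1) (2 * q + 1) > 0" for q
    using top_coeff_newton_poly_diff[of q 1] a assms by (simp add: top_coeff_def)
  have rec: "coeff (newton_poly P (Suc q) 0 - newton_poly Q (Suc q) 0) k =
    coeff (P 0 * (newton_poly P q 0 - newton_poly Q q 0)) k / real (Suc q)
    - coeff (newton_poly P q 1 - newton_poly Q q 1) k" for q k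
    unfolding newton_poly_Suc_diff using eq0 by simp
  show ?thesis
  proof (induction q)
    case 0
    then show ?case unfolding rec using rest[of 0] eq0 by simp
  next
    case (Suc q)
    let ?D = "newton_poly P (Suc q) 0 - newton_poly Q (Suc q) 0"
    \<comment> \<open>The vanishing coefficient at \<open>r = 0\<close> lowers the degree bound to
      \<open>2 * q + 1\<close>, so the negative coefficient from the induction hypothesis sits at
      the top and multiplies with \<open>b\<close>.\<close>
    have "top_coeff (2 * Suc q) 0 ?D"
      using top_coeff_newton_poly_diff[of "Suc q" 0] eq0 by simp
    then have "degree ?D \<le> 2 * q + 1"
      by (intro degree_le_if_coeff_eq_0[of _ "2 * q + 1"]) (simp_all add: top_coeff_def del: newton_poly.simps)
    then have "top_coeff (2 * q + 1) (coeff ?D (2 * q + 1)) ?D"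
      by (simp only: top_coeff_def)
    moreover have "top_coeff 2 b (P 0)" using degP[of 0] b by (simp add: top_coeff_def)
    ultimately have "top_coeff (2 + (2 * q + 1)) (b * coeff ?D (2 * q + 1)) (P 0 * ?D)"
      by (rule top_coeff_mult[rotated])
    then have "coeff (P 0 * ?D) (2 * Suc q + 1) = b * coeff ?D (2 * q + 1)"
      by (simp add: top_coeff_def)
    moreover have "b * coeff ?D (2 * q + 1) < 0" using Suc.IH assms by (simp add: mult_pos_neg)
    ultimately have "coeff (P 0 * ?D) (2 * Suc q + 1) / real (Suc (Suc q)) < 0"
      by (simp add: divide_neg_pos)
    then show ?case unfolding rec[of "Suc q"] using rest[of "Suc q"] by linarith
  qed
qed

end

subsection \<open>Constituents and period of the counting function\<close>

lemma num_placements_le: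
  assumes "inj h" "h ` square_board n \<subseteq> square_board n"
    and "\<And>z w. attacks m' (h z) (h w) \<longleftrightarrow> attacks m z w"
  shows "num_placements m q n \<le> num_placements m' q n"
  unfolding num_placements_def
proof (rule card_inj_on_le[of "image h"])
  show "inj_on (image h) (nonattacking_placements m q n)"
    using assms(1) by (auto intro!: inj_onI simp: inj_image_eq_iff)
  show "image h ` nonattacking_placements m q n \<subseteq> nonattacking_placements m' q n"
  proof (rule image_subsetI)
    fix S assume "S \<in> nonattacking_placements m q n"
    then have S: "S \<subseteq> square_board n" "card S = q" "pairwise (\<lambda>z w. \<not> attacks m z w) S"
      by (simp_all add: nonattacking_placements_def)
    have "card (h ` S) = q"
      using S(2) card_image[OF inj_on_subset[OF assms(1) subset_UNIV]] by simp
    moreover have "h ` S \<subseteq> square_board n" using S(1) assms(2) by blast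
    moreover have "pairwise (\<lambda>z w. \<not> attacks m' z w) (h ` S)"
      using S(3) by (auto simp: pairwise_def assms(3))
    ultimately show "h ` S \<in> nonattacking_placements m' q n"
      by (simp add: nonattacking_placements_def)
  qed
  show "finite (nonattacking_placements m' q n)"
    by (rule finite_subset[of _ "Pow (square_board n)"])
      (auto simp: nonattacking_placements_def square_board_def)
qed

text \<open>Exchanging coordinates is an involution, so the one-sided estimate holds in both
  directions.\<close>

lemma num_placements_swap: "num_placements (c, d) q n = num_placements (d, c) q n"
proof -
  have "num_placements (c, d) q n \<le> num_placements (d, c) q n" for c d
    by (rule num_placements_le[of prod.swap]) (auto simp: square_board_def attacks_def inj_def)
  then show ?thesis by (metis order_antisym)
qed

lemma num_placements_uminus: "num_placements (- c, d) q n = num_placements (c, d) q n"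
proof -
  have "num_placements (c, d) q n \<le> num_placements (- c, d) q n" for c
  \<comment> \<open>Reflection of the first coordinate within the board; it negates the first
    component of every difference.\<close>
  proof (rule num_placements_le[of "\<lambda>z. (int n + 1 - fst z, snd z)"])
    fix z w
    show "attacks (- c, d) (int n + 1 - fst z, snd z) (int n + 1 - fst w, snd w) = attacks (c, d) z w"
      unfolding attacks_def fst_conv snd_conv by (intro ex_cong1) auto
  qed (auto simp: square_board_def inj_def prod_eq_iff)
  from this[of c] this[of "- c"] show ?thesis by simp
qed

lemma num_placements_abs: "num_placements (c, d) q n = num_placements (\<bar>c\<bar>, \<bar>d\<bar>) q n"
proof -
  have *: "num_placements (\<bar>c\<bar>, d) q n = num_placements (c, d) q n" for c d
    by (cases "c \<ge> 0") (simp_all add: num_placements_uminus)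
  have "num_placements (c, d) q n = num_placements (d, \<bar>c\<bar>) q n"
    by (simp only: *[symmetric, of c d] num_placements_swap[of d])
  also have "\<dots> = num_placements (\<bar>d\<bar>, \<bar>c\<bar>) q n" by (simp only: *)
  also have "\<dots> = num_placements (\<bar>c\<bar>, \<bar>d\<bar>) q n" by (rule num_placements_swap)
  finally show ?thesis .
qed

section \<open>Constituents of the counting function and the least period\<close>

definition placement_poly :: "int \<Rightarrow> int \<Rightarrow> nat \<Rightarrow> real \<Rightarrow> real poly" where
  "placement_poly c d q \<sigma> = smult (1 / real q) (newton_poly (chain_sum_poly c d \<sigma>) (q - 1) 0)"

lemma num_placements_eq_poly:
  assumes "0 \<le> c" "c \<le> d" "1 \<le> d" "1 \<le> q"
  shows "real (num_placements (c, d) q n) =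
    poly (placement_poly c d q (real (n mod nat d) / d)) (real n / d)"
proof -
  have "nonattacking_placements (c, d) q n = independent_sets (attacks (c, d)) q (square_board n)"
    by (simp add: nonattacking_placements_def independent_sets_def)
  then show ?thesis
    using card_independent_eq_poly[OF equivp_attacks finite_square_board poly_chain_sum_poly[OF assms(1-3)],
        of "q - 1" n] assms(4)
    by (simp add: num_placements_def placement_poly_def)
qed

text \<open>With \<open>k = q - 2\<close>, the two polynomials differ in the coefficient of degree
  \<open>2 * k + 1 = 2 * q - 3\<close>.\<close>

lemma placement_poly_neq:
  assumes "0 \<le> c" "c < d" "2 \<le> q" "0 < \<sigma>" "\<sigma> < 1"
  shows "placement_poly c d q \<sigma> \<noteq> placement_poly c d q 0"
proof
  assume eq: "placement_poly c d q \<sigma> = placement_poly c d q 0"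
  let ?P = "chain_sum_poly c d"
  define k where "k = q - 2"
  have k: "q = Suc (Suc k)" using assms(3) by (simp add: k_def)
  have "coeff (newton_poly (?P \<sigma>) (Suc k) 0 - newton_poly (?P 0) (Suc k) 0) (2 * k + 1) < 0"
  proof (rule coeff_newton_poly_diff_neg[where P = "?P \<sigma>" and Q = "?P 0", OF _ _ _ _ refl coeff_chain_sum_poly_1_diff])
    show "?P \<sigma> 0 = ?P 0 0" "0 < coeff (?P \<sigma> 0) 2"
      using assms by (simp_all add: chain_sum_poly_def numeral_2_eq_2)
    show "0 < real_of_int d * (real_of_int d - real_of_int c) * \<sigma> * (1 - \<sigma>)"
      using assms by simp
  qed (rule degree_chain_sum_poly degree_chain_sum_poly_diff)+
  moreover have "newton_poly (?P \<sigma>) (Suc k) 0 = newton_poly (?P 0) (Suc k) 0"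
    using arg_cong[OF eq, of "smult (real q)"]
    by (simp add: placement_poly_def k del: newton_poly.simps of_nat_Suc)
  ultimately show False by (simp del: newton_poly.simps)
qed

lemma quasi_period_num_placements:
  assumes "0 \<le> c" "c \<le> d" "1 \<le> d" "gcd c d = 1" "2 \<le> q"
  defines "u \<equiv> \<lambda>n. real (num_placements (c, d) q n)"
  shows "quasipolynomial_with (nat d) u" and "quasi_period u = nat d"
proof -
  define F where "F s = placement_poly c d q (real s / d)" for s :: nat
  have u: "u n = poly (F (n mod nat d)) (real n / d)" for n
    using num_placements_eq_poly[OF assms(1-3)] assms(5) by (simp add: u_def F_def)
  then have "u n = poly (pcompose (F (n mod nat d)) [:0, 1 / real_of_int d:]) (real n)" for n
    by (simp add: poly_pcompose)
  then show with_d: "quasipolynomial_with (nat d) u"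
    using assms(3) unfolding quasipolynomial_with_def
    by (intro conjI exI[of _ "\<lambda>s. pcompose (F s) [:0, 1 / real_of_int d:]"]) auto
  have "nat d \<le> p" if "quasipolynomial_with p u" for p
  proof (rule ccontr)
    assume p: "\<not> nat d \<le> p"
    obtain g where "1 \<le> p" and g: "\<And>n. u n = poly (g (n mod p)) (real n)"
      using \<open>quasipolynomial_with p u\<close> by (auto simp: quasipolynomial_with_def)
    \<comment> \<open>If \<open>c = d\<close>, coprimality forces \<open>d = 1\<close>, and no
      \<open>p\<close> with \<open>1 <= p < d\<close> is left.\<close>
    have "c \<noteq> d" using assms p \<open>1 \<le> p\<close> by auto
    \<comment> \<open>The numbers \<open>nat d * p * k + s\<close> are multiples of
      \<open>p\<close>, hence governed by \<open>g 0\<close>, yet congruent to \<open>s\<close>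
      modulo \<open>d\<close> because \<open>p < d\<close>. There are infinitely many, so
      \<open>F 0\<close> and \<open>F p\<close> are the same polynomial.\<close>
    have Fg: "F s = pcompose (g 0) [:0, real_of_int d:]" if s: "s = 0 \<or> s = p" for s
    proof (rule poly_eq_if_eq_on_infinite)
      let ?X = "range (\<lambda>k. real (nat d * p * k + s) / d)"
      show "infinite ?X"
        using assms(3) \<open>1 \<le> p\<close> by (intro range_inj_infinite) (auto simp: inj_def)
      fix x assume "x \<in> ?X"
      then obtain k where x: "x = real (nat d * p * k + s) / d" by auto
      have "(nat d * p * k + s) mod nat d = s" "(nat d * p * k + s) mod p = 0"
        using s p assms(3) by (auto simp: mult.assoc)
      then show "poly (F s) x = poly (pcompose (g 0) [:0, real_of_int d:]) x"
        using u[of "nat d * p * k + s"] g[of "nat d * p * k + s"] assms(3)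
        by (simp add: x poly_pcompose)
    qed
    have "F p = F 0" using Fg[of 0] Fg[of p] by simp
    moreover have "F p \<noteq> F 0"
      using placement_poly_neq[of c d q "real p / d"] assms p \<open>1 \<le> p\<close> \<open>c \<noteq> d\<close>
      by (simp add: F_def)
    ultimately show False by (simp del: newton_poly.simps)
  qed
  then show "quasi_period u = nat d"
    unfolding quasi_period_def by (intro Least_equality with_d)
qed

theorem theorem3p2:
  fixes c d :: int and q :: nat
  assumes "(c, d) \<noteq> (0, 0)" and "gcd c d = 1" and "q \<ge> 2"
  shows "quasipolynomial (\<lambda>n. real (num_placements (c, d) q n)) \<and>
    int (quasi_period (\<lambda>n. real (num_placements (c, d) q n))) = max \<bar>c\<bar> \<bar>d\<bar>"
proof -
  define a where "a = min \<bar>c\<bar> \<bar>d\<bar>"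
  define b where "b = max \<bar>c\<bar> \<bar>d\<bar>"
  have "num_placements (c, d) q n = num_placements (a, b) q n" for n
    using num_placements_abs[of c d] num_placements_swap[of "\<bar>c\<bar>" "\<bar>d\<bar>"]
    by (auto simp: a_def b_def min_def max_def)
  moreover have "0 \<le> a" "a \<le> b" "1 \<le> b" using assms(1) by (auto simp: a_def b_def)
  moreover have "gcd a b = 1"
    using assms(2) by (auto simp: a_def b_def min_def max_def gcd.commute)
  ultimately show ?thesis
    using quasi_period_num_placements[of a b q] assms(3)
    by (auto simp: quasipolynomial_def b_def[symmetric])
qed

end
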